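(* Let $L>0$, $\rho\ge0$, let $F:\mathbb{R}^d\to\mathbb{R}^d$ be $L$-Lipschitz and $\rho$-star-negative comonotone with $\rho<\frac{1}{2L}$, and let $x^*$ satisfy $F(x^* )=0$. Then, for any $2\rho<\gamma_1<\frac1L$ and $0<\gamma_2\le\gamma_1-2\rho$, the iterates produced by the Extragradient method with stepsizes $\gamma_1,\gamma_2$ from any $x^0\in\mathbb{R}^d$ satisfy, for all $N\ge0$, $$\frac{1}{N+1}\sum_{k=0}^N\|F(x^k)\|^2\le\frac{\|x^0-x^*\|^2}{\gamma_1\gamma_2(1-L^2\gamma_1^2)(N+1)}.$$ If, in addition, $F$ is $\rho$-negative comonotone with $\rho\le\frac{1}{8L}$ and $\gamma_1=\gamma_2=\gamma$ (in place of the conditions $2\rho<\gamma_1<\frac1L$ and $0<\gamma_2\le\gamma_1-2\rho$ on the stepsizes) with $\gamma>0$ and $4\rho\le\gamma\le\frac{1}{2L}$, then for any $k\ge0$ the iterates produced by the Extragradient method satisfy $\|F(x^{k+1})\|\le\|F(x^k)\|$, and for any $N\ge1$ $$\|F(x^N)\|^2\le\frac{28\|x^0-x^*\|^2}{N\gamma^2+320\gamma\rho}.$$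
   Context: For a single-valued operator $F:\mathbb{R}^d\to\mathbb{R}^d$ and $\rho\ge0$: $F$ is $L$-Lipschitz if $\|F(x)-F(y)\|\le L\|x-y\|$ for all $x,y$; $F$ is $\rho$-negative comonotone if $\langle F(x)-F(y),x-y\rangle\ge-\rho\|F(x)-F(y)\|^2$ for all $x,y$; $F$ is $\rho$-star-negative comonotone if $\langle F(x),x-x^*\rangle\ge-\rho\|F(x)\|^2$ for all $x$ and $x^*$ a solution, where a solution is a point $x^*$ with $F(x^* )=0$ (assumed to exist). The Extragradient method with stepsizes $\gamma_1,\gamma_2$ generates from $x^0$: $\widetilde x^k=x^k-\gamma_1F(x^k)$, $x^{k+1}=x^k-\gamma_2F(\widetilde x^k)$ for all $k\ge0$. *)

theory Defs
  imports "HOL-Analysis.Analysis"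
begin

definition neg_comonotone :: "real \<Rightarrow> (real ^ 'd \<Rightarrow> real ^ 'd) \<Rightarrow> bool" where
  "neg_comonotone \<rho> F \<longleftrightarrow>
     (\<forall>x y. inner (F x - F y) (x - y) \<ge> - \<rho> * (norm (F x - F y))\<^sup>2)"

text \<open>The inequality is required at every zero of \<open>F\<close>, not just at one chosen solution.
  Existence of a zero is not part of the definition.\<close>

definition star_neg_comonotone :: "real \<Rightarrow> (real ^ 'd \<Rightarrow> real ^ 'd) \<Rightarrow> bool" where
  "star_neg_comonotone \<rho> F \<longleftrightarrow>
     (\<forall>x xs. F xs = 0 \<longrightarrow> inner (F x) (x - xs) \<ge> - \<rho> * (norm (F x))\<^sup>2)"

definition eg_extrapolate :: "(real ^ 'd \<Rightarrow> real ^ 'd) \<Rightarrow> real \<Rightarrow> real ^ 'd \<Rightarrow> real ^ 'd" where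
  "eg_extrapolate F \<gamma>1 x = x - \<gamma>1 *\<^sub>R F x"

primrec eg_iterate ::
  "(real ^ 'd \<Rightarrow> real ^ 'd) \<Rightarrow> real \<Rightarrow> real \<Rightarrow> real ^ 'd \<Rightarrow> nat \<Rightarrow> real ^ 'd" where
  "eg_iterate F \<gamma>1 \<gamma>2 x0 0 = x0"
| "eg_iterate F \<gamma>1 \<gamma>2 x0 (Suc k) =
     eg_iterate F \<gamma>1 \<gamma>2 x0 k - \<gamma>2 *\<^sub>R F (eg_extrapolate F \<gamma>1 (eg_iterate F \<gamma>1 \<gamma>2 x0 k))"

end

theory Submission
  imports Defs
begin

text \<open>
  Write \<open>a = F x\<close>, \<open>b = F (x - \<gamma>1 a)\<close> and \<open>c = F (x - \<gamma>2 b)\<close> for the operator values seen in one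
  extragradient step.  Expanding the squared distance to a solution and applying
  star-comonotonicity at the extrapolated point (\<open>eg_distance_step\<close>) gives
  \<open>\<parallel>x\<^sup>+ - x\<^sup>*\<parallel>\<^sup>2 \<le> \<parallel>x - x\<^sup>*\<parallel>\<^sup>2 + (\<gamma>2\<^sup>2 + 2 \<gamma>2 \<rho>) \<parallel>b\<parallel>\<^sup>2 - 2 \<gamma>1 \<gamma>2 \<langle>a, b\<rangle>\<close>.
  Polarising \<open>\<langle>a, b\<rangle>\<close> and bounding \<open>\<parallel>a - b\<parallel> \<le> L \<gamma>1 \<parallel>a\<parallel>\<close>, the condition \<open>\<gamma>2 \<le> \<gamma>1 - 2 \<rho>\<close> makes the
  coefficient of \<open>\<parallel>b\<parallel>\<^sup>2\<close> nonpositive, and telescoping yields the averaged rate.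

  With equal stepsizes the coefficient of \<open>\<parallel>b\<parallel>\<^sup>2\<close> is \<open>2 \<gamma> \<rho> \<ge> 0\<close>, so the distance alone need not
  decrease.  Full comonotonicity compensates for this: tested on the pairs (iterate, next iterate)
  and (extrapolated point, next iterate), it gives
  \<open>\<parallel>c\<parallel>\<^sup>2 \<le> \<parallel>a\<parallel>\<^sup>2 - \<parallel>a - b\<parallel>\<^sup>2 / 16\<close>, which is the monotonicity of the residual with some slack
  (\<open>residual_decrease_algebra\<close>).  Tested on (iterate, extrapolated point) it bounds the growth of
  \<open>\<parallel>b\<parallel>\<close> over \<open>\<parallel>a\<parallel>\<close>.  Hence the potential
  \<open>\<parallel>x\<^sub>k - x\<^sup>*\<parallel>\<^sup>2 + (k \<gamma>\<^sup>2 / 8 + 40 \<gamma> \<rho>) \<parallel>F x\<^sub>k\<parallel>\<^sup>2\<close> is nonincreasing: the term \<open>-\<gamma>\<^sup>2 \<parallel>a\<parallel>\<^sup>2\<close> of the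
  distance estimate pays for the growth \<open>\<gamma>\<^sup>2 / 8\<close> of the weight and for the \<open>\<parallel>a\<parallel>\<^sup>2\<close> part of
  \<open>2 \<gamma> \<rho> \<parallel>b\<parallel>\<^sup>2\<close>, while the weight \<open>40 \<gamma> \<rho>\<close>, present from the start, turns the slack in the
  residual decrease into \<open>-5/2 \<gamma> \<rho> \<parallel>a - b\<parallel>\<^sup>2\<close> against the remaining part.  Its
  initial value is at most \<open>(1 + 40/16) \<parallel>x\<^sub>0 - x\<^sup>*\<parallel>\<^sup>2\<close>, and \<open>28 = 8 (1 + 40/16)\<close>.
\<close>

section \<open>Distance to a solution\<close>

lemma lipschitz_norm_sq_le:
  fixes F :: "'a::real_normed_vector \<Rightarrow> 'b::real_normed_vector"
  assumes "L-lipschitz_on UNIV F"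
  shows "(norm (F x - F y))\<^sup>2 \<le> L\<^sup>2 * (norm (x - y))\<^sup>2"
proof -
  have "norm (F x - F y) \<le> L * norm (x - y)"
    using lipschitz_onD[OF assms, of x y] by (simp add: dist_norm)
  then have "(norm (F x - F y))\<^sup>2 \<le> (L * norm (x - y))\<^sup>2"
    by (rule power_mono) simp
  then show ?thesis by (simp add: power_mult_distrib)
qed

lemma extrapolation_change_sq_le:
  assumes "L-lipschitz_on UNIV F"
  shows "(norm (F x - F (eg_extrapolate F \<gamma> x)))\<^sup>2 \<le> L\<^sup>2 * \<gamma>\<^sup>2 * (norm (F x))\<^sup>2"
  using lipschitz_norm_sq_le[OF assms, of x "eg_extrapolate F \<gamma> x"]
  by (simp add: eg_extrapolate_def power_mult_distrib mult.assoc)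

text \<open>Star-comonotonicity is applied at the extrapolated point, where the update direction is
  evaluated; replacing that point by the iterate costs the term \<open>\<gamma>1 \<langle>F x, F x'\<rangle>\<close>.\<close>

lemma eg_distance_step:
  fixes F :: "real ^ 'd \<Rightarrow> real ^ 'd" and x xs :: "real ^ 'd" and \<gamma>1 \<gamma>2 \<rho> :: real
  assumes star: "star_neg_comonotone \<rho> F" and sol: "F xs = 0" and "\<gamma>2 \<ge> 0"
  defines "b \<equiv> F (eg_extrapolate F \<gamma>1 x)"
  shows "(norm (x - \<gamma>2 *\<^sub>R b - xs))\<^sup>2
       \<le> (norm (x - xs))\<^sup>2 + (\<gamma>2\<^sup>2 + 2 * \<gamma>2 * \<rho>) * (norm b)\<^sup>2 - 2 * \<gamma>1 * \<gamma>2 * inner (F x) b"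
proof -
  have "inner b (eg_extrapolate F \<gamma>1 x - xs) \<ge> - \<rho> * (norm b)\<^sup>2"
    using star sol unfolding star_neg_comonotone_def b_def by blast
  then have "inner b (x - xs) \<ge> \<gamma>1 * inner (F x) b - \<rho> * (norm b)\<^sup>2"
    by (simp add: eg_extrapolate_def inner_diff_right inner_commute)
  from mult_left_mono[OF this, of "2 * \<gamma>2"] \<open>\<gamma>2 \<ge> 0\<close>
  have "2 * \<gamma>2 * inner b (x - xs) \<ge> 2 * \<gamma>2 * (\<gamma>1 * inner (F x) b - \<rho> * (norm b)\<^sup>2)"
    by simp
  moreover have "(norm (x - \<gamma>2 *\<^sub>R b - xs))\<^sup>2
      = (norm (x - xs))\<^sup>2 - 2 * \<gamma>2 * inner b (x - xs) + \<gamma>2\<^sup>2 * (norm b)\<^sup>2"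
    unfolding power2_norm_eq_inner
    by (simp add: inner_diff inner_commute power2_eq_square algebra_simps)
  ultimately show ?thesis by (simp add: algebra_simps)
qed

lemma eg_distance_decrease:
  fixes F :: "real ^ 'd \<Rightarrow> real ^ 'd"
  assumes lip: "L-lipschitz_on UNIV F"
    and star: "star_neg_comonotone \<rho> F" and sol: "F xs = 0"
    and "\<gamma>1 \<ge> 0" and "\<gamma>2 \<ge> 0" and step: "\<gamma>2 \<le> \<gamma>1 - 2 * \<rho>"
  shows "\<gamma>1 * \<gamma>2 * (1 - L\<^sup>2 * \<gamma>1\<^sup>2) * (norm (F x))\<^sup>2
       \<le> (norm (x - xs))\<^sup>2 - (norm (x - \<gamma>2 *\<^sub>R F (eg_extrapolate F \<gamma>1 x) - xs))\<^sup>2"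
proof -
  define a b where "a = F x" and "b = F (eg_extrapolate F \<gamma>1 x)"
  have dist: "(norm (x - \<gamma>2 *\<^sub>R b - xs))\<^sup>2
      \<le> (norm (x - xs))\<^sup>2 + (\<gamma>2\<^sup>2 + 2 * \<gamma>2 * \<rho>) * (norm b)\<^sup>2 - 2 * \<gamma>1 * \<gamma>2 * inner a b"
    using eg_distance_step[OF star sol \<open>\<gamma>2 \<ge> 0\<close>] unfolding a_def b_def .
  have polar: "2 * inner a b = (norm a)\<^sup>2 + (norm b)\<^sup>2 - (norm (a - b))\<^sup>2"
    by (simp add: power2_norm_eq_inner inner_diff inner_commute)
  have "(norm (a - b))\<^sup>2 \<le> L\<^sup>2 * \<gamma>1\<^sup>2 * (norm a)\<^sup>2"
    unfolding a_def b_def by (rule extrapolation_change_sq_le[OF lip])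
  then have "(1 - L\<^sup>2 * \<gamma>1\<^sup>2) * (norm a)\<^sup>2 + (norm b)\<^sup>2 \<le> 2 * inner a b"
    using polar by (simp add: algebra_simps)
  from mult_left_mono[OF this, of "\<gamma>1 * \<gamma>2"] \<open>\<gamma>1 \<ge> 0\<close> \<open>\<gamma>2 \<ge> 0\<close>
  have cross: "\<gamma>1 * \<gamma>2 * ((1 - L\<^sup>2 * \<gamma>1\<^sup>2) * (norm a)\<^sup>2 + (norm b)\<^sup>2) \<le> 2 * \<gamma>1 * \<gamma>2 * inner a b"
    by simp
  have "\<gamma>2 * (\<gamma>2 + 2 * \<rho> - \<gamma>1) * (norm b)\<^sup>2 \<le> 0"
    using \<open>\<gamma>2 \<ge> 0\<close> step by (intro mult_nonpos_nonneg mult_nonneg_nonpos) auto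
  with dist cross show ?thesis
    unfolding a_def b_def by (simp add: algebra_simps power2_eq_square)
qed

section \<open>Monotonicity of the residual\<close>

text \<open>The three values satisfy \<open>\<parallel>c\<parallel>\<^sup>2 = \<parallel>a\<parallel>\<^sup>2 - \<parallel>a - b\<parallel>\<^sup>2 + \<parallel>b - c\<parallel>\<^sup>2 - 2 \<langle>a - c, b\<rangle>\<close>.  The first hypothesis
  bounds the last term by \<open>\<parallel>a - c\<parallel>\<^sup>2 / 2\<close>.  The triangle inequality would be too lossy there; instead
  the second hypothesis gives \<open>\<parallel>a - c\<parallel>\<^sup>2 \<le> \<parallel>a - b\<parallel>\<^sup>2 + 3/2 \<parallel>b - c\<parallel>\<^sup>2\<close>, and the coefficients add up to
  \<open>-1 + 1/2 + 7/4 \<cdot> 1/4 = -1/16\<close>.\<close>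

lemma residual_decrease_algebra:
  fixes a b c :: "'a::real_inner"
  assumes "inner (a - c) b \<ge> - ((norm (a - c))\<^sup>2 / 4)"
    and "inner (b - c) (b - a) \<ge> - ((norm (b - c))\<^sup>2 / 4)"
    and "(norm (b - c))\<^sup>2 \<le> (norm (a - b))\<^sup>2 / 4"
  shows "(norm c)\<^sup>2 \<le> (norm a)\<^sup>2 - (norm (a - b))\<^sup>2 / 16"
  using assms by (simp add: power2_norm_eq_inner inner_diff inner_commute field_simps)

text \<open>Dividing by the stepsize turns comonotonicity along a displacement \<open>\<gamma> v\<close> into an inequality
  between operator values only, with the single constant \<open>1/4 \<ge> \<rho> / \<gamma>\<close>.\<close>

lemma neg_comonotone_along_step:
  fixes F :: "real ^ 'd \<Rightarrow> real ^ 'd"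
  assumes com: "neg_comonotone \<rho> F" and "\<gamma> > 0" and "4 * \<rho> \<le> \<gamma>" and disp: "x - y = \<gamma> *\<^sub>R v"
  shows "inner (F x - F y) v \<ge> - ((norm (F x - F y))\<^sup>2 / 4)"
proof -
  let ?n = "(norm (F x - F y))\<^sup>2"
  have "- \<rho> * ?n \<le> \<gamma> * inner (F x - F y) v"
    using com unfolding neg_comonotone_def by (metis disp inner_scaleR_right)
  moreover have "\<rho> * ?n \<le> \<gamma> / 4 * ?n"
    using \<open>4 * \<rho> \<le> \<gamma>\<close> by (intro mult_right_mono) auto
  ultimately have "\<gamma> * - (?n / 4) \<le> \<gamma> * inner (F x - F y) v" by simp
  then show ?thesis using \<open>\<gamma> > 0\<close> by (simp only: mult_le_cancel_left_pos)
qed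

lemma eg_residual_decrease:
  fixes F :: "real ^ 'd \<Rightarrow> real ^ 'd" and x :: "real ^ 'd" and \<gamma> \<rho> :: real
  assumes lip: "L-lipschitz_on UNIV F" and com: "neg_comonotone \<rho> F"
    and "\<gamma> > 0" and "4 * \<rho> \<le> \<gamma>" and contr: "L\<^sup>2 * \<gamma>\<^sup>2 \<le> 1 / 4"
  defines "b \<equiv> F (eg_extrapolate F \<gamma> x)"
  shows "(norm (F (x - \<gamma> *\<^sub>R b)))\<^sup>2 \<le> (norm (F x))\<^sup>2 - (norm (F x - b))\<^sup>2 / 16"
proof (rule residual_decrease_algebra)
  note along = neg_comonotone_along_step[OF com \<open>\<gamma> > 0\<close> \<open>4 * \<rho> \<le> \<gamma>\<close>]
  have disp: "eg_extrapolate F \<gamma> x - (x - \<gamma> *\<^sub>R b) = \<gamma> *\<^sub>R (b - F x)"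
    by (simp add: eg_extrapolate_def scaleR_diff_right)
  show "inner (F x - F (x - \<gamma> *\<^sub>R b)) b \<ge> - ((norm (F x - F (x - \<gamma> *\<^sub>R b)))\<^sup>2 / 4)"
    by (rule along) simp
  show "inner (b - F (x - \<gamma> *\<^sub>R b)) (b - F x) \<ge> - ((norm (b - F (x - \<gamma> *\<^sub>R b)))\<^sup>2 / 4)"
    unfolding b_def by (rule along[OF disp[unfolded b_def]])
  have "(norm (b - F (x - \<gamma> *\<^sub>R b)))\<^sup>2 \<le> L\<^sup>2 * \<gamma>\<^sup>2 * (norm (F x - b))\<^sup>2"
    using lipschitz_norm_sq_le[OF lip, of "eg_extrapolate F \<gamma> x" "x - \<gamma> *\<^sub>R b"]
    unfolding disp b_def[symmetric]
    by (simp add: power_mult_distrib mult.assoc norm_minus_commute)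
  also have "\<dots> \<le> 1 / 4 * (norm (F x - b))\<^sup>2"
    using contr by (rule mult_right_mono) simp
  finally show "(norm (b - F (x - \<gamma> *\<^sub>R b)))\<^sup>2 \<le> (norm (F x - b))\<^sup>2 / 4" by simp
qed

section \<open>The potential for equal stepsizes\<close>

text \<open>Comonotonicity between the iterate and the extrapolated point sharpens the Lipschitz estimate
  \<open>\<parallel>b\<parallel>\<^sup>2 \<le> 9/4 \<parallel>a\<parallel>\<^sup>2\<close> to \<open>\<parallel>b\<parallel>\<^sup>2 \<le> \<parallel>a\<parallel>\<^sup>2 + 3/2 \<parallel>a - b\<parallel>\<^sup>2\<close>.  The weight
  \<open>40 \<gamma> \<rho>\<close> on the residual decrease contributes \<open>-5/2 \<gamma> \<rho> \<parallel>a - b\<parallel>\<^sup>2\<close>, cancelling most of the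
  resulting \<open>3 \<gamma> \<rho> \<parallel>a - b\<parallel>\<^sup>2\<close>.  With \<open>\<parallel>a - b\<parallel>\<^sup>2 \<le> \<parallel>a\<parallel>\<^sup>2 / 4\<close> and \<open>r = \<rho> / \<gamma> \<le> 1/4\<close>, the change of the potential is then at most
  \<open>\<gamma>\<^sup>2 \<parallel>a\<parallel>\<^sup>2\<close> times \<open>2 r + r / 8 + 1/4 - 1 + 1/8 \<le> - 3/32\<close>.\<close>

lemma eg_potential_step:
  fixes F :: "real ^ 'd \<Rightarrow> real ^ 'd" and x xs :: "real ^ 'd" and \<gamma> \<rho> :: real
  assumes lip: "L-lipschitz_on UNIV F"
    and star: "star_neg_comonotone \<rho> F" and sol: "F xs = 0"
    and com: "neg_comonotone \<rho> F"
    and "\<gamma> > 0" and "\<rho> \<ge> 0" and "4 * \<rho> \<le> \<gamma>" and contr: "L\<^sup>2 * \<gamma>\<^sup>2 \<le> 1 / 4"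
    and A: "A \<ge> 40 * \<gamma> * \<rho>"
  defines "b \<equiv> F (eg_extrapolate F \<gamma> x)"
  shows "(norm (x - \<gamma> *\<^sub>R b - xs))\<^sup>2 + (A + \<gamma>\<^sup>2 / 8) * (norm (F (x - \<gamma> *\<^sub>R b)))\<^sup>2
       \<le> (norm (x - xs))\<^sup>2 + A * (norm (F x))\<^sup>2"
proof -
  define a c where "a = F x" and "c = F (x - \<gamma> *\<^sub>R b)"
  define d where "d = (norm (a - b))\<^sup>2"
  have dist: "(norm (x - \<gamma> *\<^sub>R b - xs))\<^sup>2
      \<le> (norm (x - xs))\<^sup>2 + (\<gamma>\<^sup>2 + 2 * \<gamma> * \<rho>) * (norm b)\<^sup>2 - 2 * \<gamma> * \<gamma> * inner a b"
    using eg_distance_step[OF star sol, of \<gamma> x \<gamma>] \<open>\<gamma> > 0\<close> unfolding a_def b_def by simp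
  have polar: "2 * inner a b = (norm a)\<^sup>2 + (norm b)\<^sup>2 - d"
    by (simp add: d_def power2_norm_eq_inner inner_diff inner_commute)
  have dist': "(norm (x - \<gamma> *\<^sub>R b - xs))\<^sup>2
      \<le> (norm (x - xs))\<^sup>2 + 2 * (\<gamma> * \<rho>) * (norm b)\<^sup>2 + \<gamma>\<^sup>2 * d - \<gamma>\<^sup>2 * (norm a)\<^sup>2"
  proof -
    have "2 * \<gamma> * \<gamma> * inner a b = \<gamma>\<^sup>2 * (2 * inner a b)" by (simp add: power2_eq_square)
    then show ?thesis using dist unfolding polar by (simp add: algebra_simps)
  qed
  have res: "(norm c)\<^sup>2 \<le> (norm a)\<^sup>2 - d / 16"
    unfolding a_def b_def c_def d_def
    by (rule eg_residual_decrease[OF lip com \<open>\<gamma> > 0\<close> \<open>4 * \<rho> \<le> \<gamma>\<close> contr])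
  have d_le: "d \<le> (norm a)\<^sup>2 / 4"
  proof -
    have "d \<le> L\<^sup>2 * \<gamma>\<^sup>2 * (norm a)\<^sup>2"
      unfolding a_def b_def d_def by (rule extrapolation_change_sq_le[OF lip])
    also have "\<dots> \<le> 1 / 4 * (norm a)\<^sup>2"
      using contr by (rule mult_right_mono) simp
    finally show ?thesis by simp
  qed
  have "inner (a - b) a \<ge> - (d / 4)"
    unfolding a_def b_def d_def
    by (rule neg_comonotone_along_step[OF com \<open>\<gamma> > 0\<close> \<open>4 * \<rho> \<le> \<gamma>\<close>])
      (simp add: eg_extrapolate_def)
  then have b_le: "(norm b)\<^sup>2 \<le> (norm a)\<^sup>2 + 3 / 2 * d"
    by (simp add: d_def power2_norm_eq_inner inner_diff inner_commute field_simps)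
  have "\<gamma> * \<rho> \<ge> 0" using \<open>\<gamma> > 0\<close> \<open>\<rho> \<ge> 0\<close> by simp
  have "\<gamma> * \<rho> \<le> \<gamma>\<^sup>2 / 4"
    using mult_left_mono[OF \<open>4 * \<rho> \<le> \<gamma>\<close>, of \<gamma>] \<open>\<gamma> > 0\<close> by (simp add: power2_eq_square)
  have "d \<ge> 0" by (simp add: d_def)
  have res_weighted: "(A + \<gamma>\<^sup>2 / 8) * (norm c)\<^sup>2
      \<le> (A + \<gamma>\<^sup>2 / 8) * (norm a)\<^sup>2 - 5 / 2 * (\<gamma> * \<rho>) * d"
  proof -
    have w: "40 * (\<gamma> * \<rho>) \<le> A + \<gamma>\<^sup>2 / 8"
      using A zero_le_power2[of \<gamma>] by linarith
    then have "(A + \<gamma>\<^sup>2 / 8) * (norm c)\<^sup>2 \<le> (A + \<gamma>\<^sup>2 / 8) * ((norm a)\<^sup>2 - d / 16)"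
      using res \<open>\<gamma> * \<rho> \<ge> 0\<close> by (intro mult_left_mono) auto
    moreover have "40 * (\<gamma> * \<rho>) * (d / 16) \<le> (A + \<gamma>\<^sup>2 / 8) * (d / 16)"
      using w \<open>d \<ge> 0\<close> by (intro mult_right_mono) auto
    ultimately show ?thesis by (simp add: algebra_simps)
  qed
  have "2 * (\<gamma> * \<rho>) * (norm b)\<^sup>2 \<le> 2 * (\<gamma> * \<rho>) * ((norm a)\<^sup>2 + 3 / 2 * d)"
    using b_le \<open>\<gamma> * \<rho> \<ge> 0\<close> by (intro mult_left_mono) auto
  moreover have "(\<gamma> * \<rho>) * (2 * (norm a)\<^sup>2 + d / 2) \<le> \<gamma>\<^sup>2 / 4 * (2 * (norm a)\<^sup>2 + d / 2)"
    using \<open>\<gamma> * \<rho> \<le> \<gamma>\<^sup>2 / 4\<close> \<open>d \<ge> 0\<close> by (intro mult_right_mono) auto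
  moreover have "\<gamma>\<^sup>2 * (9 / 8 * d) \<le> \<gamma>\<^sup>2 * (3 / 8 * (norm a)\<^sup>2)"
  proof (rule mult_left_mono)
    show "9 / 8 * d \<le> 3 / 8 * (norm a)\<^sup>2"
      using d_le zero_le_power2[of "norm a"] by linarith
  qed simp
  ultimately show ?thesis
    using dist' res_weighted unfolding a_def[symmetric] c_def[symmetric]
    by (simp add: algebra_simps)
qed

section \<open>Convergence rates\<close>

lemma eg_sum_residuals_le:
  fixes F :: "real ^ 'd \<Rightarrow> real ^ 'd" and x0 xs :: "real ^ 'd" and \<gamma>1 \<gamma>2 \<rho> :: real
  assumes "L-lipschitz_on UNIV F"
    and "star_neg_comonotone \<rho> F" and "F xs = 0"
    and "\<gamma>1 \<ge> 0" and "\<gamma>2 \<ge> 0" and "\<gamma>2 \<le> \<gamma>1 - 2 * \<rho>"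
  defines "X \<equiv> eg_iterate F \<gamma>1 \<gamma>2 x0"
  shows "\<gamma>1 * \<gamma>2 * (1 - L\<^sup>2 * \<gamma>1\<^sup>2) * (\<Sum>k=0..N. (norm (F (X k)))\<^sup>2) \<le> (norm (x0 - xs))\<^sup>2"
proof -
  let ?C = "\<gamma>1 * \<gamma>2 * (1 - L\<^sup>2 * \<gamma>1\<^sup>2)"
  have step: "?C * (norm (F (X k)))\<^sup>2 \<le> (norm (X k - xs))\<^sup>2 - (norm (X (Suc k) - xs))\<^sup>2" for k
    using eg_distance_decrease[OF assms(1-6), of "X k"] by (simp add: X_def)
  have "?C * (\<Sum>k=0..N. (norm (F (X k)))\<^sup>2)
      \<le> (\<Sum>k=0..N. (norm (X k - xs))\<^sup>2 - (norm (X (Suc k) - xs))\<^sup>2)"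
    unfolding sum_distrib_left by (intro sum_mono step)
  also have "\<dots> = (norm (X 0 - xs))\<^sup>2 - (norm (X (Suc N) - xs))\<^sup>2"
    by (induction N) auto
  also have "\<dots> \<le> (norm (x0 - xs))\<^sup>2" by (simp add: X_def)
  finally show ?thesis .
qed

lemma eg_last_residual_le:
  fixes F :: "real ^ 'd \<Rightarrow> real ^ 'd" and x0 xs :: "real ^ 'd" and \<gamma> \<rho> :: real
  assumes lip: "L-lipschitz_on UNIV F"
    and star: "star_neg_comonotone \<rho> F" and sol: "F xs = 0"
    and com: "neg_comonotone \<rho> F"
    and "\<gamma> > 0" and "\<rho> \<ge> 0" and "4 * \<rho> \<le> \<gamma>" and contr: "L\<^sup>2 * \<gamma>\<^sup>2 \<le> 1 / 4"
  defines "X \<equiv> eg_iterate F \<gamma> \<gamma> x0"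
  shows "(real N * \<gamma>\<^sup>2 + 320 * \<gamma> * \<rho>) * (norm (F (X N)))\<^sup>2 \<le> 28 * (norm (x0 - xs))\<^sup>2"
proof -
  define A where "A k = real k * \<gamma>\<^sup>2 / 8 + 40 * \<gamma> * \<rho>" for k
  define V where "V k = (norm (X k - xs))\<^sup>2 + A k * (norm (F (X k)))\<^sup>2" for k
  have "V (Suc k) \<le> V k" for k
  proof -
    have "A k \<ge> 40 * \<gamma> * \<rho>" by (simp add: A_def)
    moreover have "A (Suc k) = A k + \<gamma>\<^sup>2 / 8" by (simp add: A_def algebra_simps)
    ultimately show ?thesis
      using eg_potential_step[OF lip star sol com \<open>\<gamma> > 0\<close> \<open>\<rho> \<ge> 0\<close> \<open>4 * \<rho> \<le> \<gamma>\<close> contr,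
          of "A k" "X k"]
      by (simp add: V_def X_def)
  qed
  then have "V N \<le> V 0" by (rule lift_Suc_antimono_le) simp
  also have "V 0 \<le> 7 / 2 * (norm (x0 - xs))\<^sup>2"
  proof -
    have "\<gamma> * \<rho> \<le> \<gamma>\<^sup>2 / 4"
      using mult_left_mono[OF \<open>4 * \<rho> \<le> \<gamma>\<close>, of \<gamma>] \<open>\<gamma> > 0\<close> by (simp add: power2_eq_square)
    then have "40 * \<gamma> * \<rho> * (norm (F x0))\<^sup>2 \<le> 10 * \<gamma>\<^sup>2 * (norm (F x0))\<^sup>2"
      by (intro mult_right_mono) auto
    also have "\<dots> \<le> 10 * \<gamma>\<^sup>2 * (L\<^sup>2 * (norm (x0 - xs))\<^sup>2)"
      using lipschitz_norm_sq_le[OF lip, of x0 xs] sol by (intro mult_left_mono) auto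
    also have "\<dots> = 10 * ((L\<^sup>2 * \<gamma>\<^sup>2) * (norm (x0 - xs))\<^sup>2)" by simp
    also have "\<dots> \<le> 10 * (1 / 4 * (norm (x0 - xs))\<^sup>2)"
      using contr by (intro mult_left_mono mult_right_mono) auto
    finally show ?thesis by (simp add: V_def A_def X_def)
  qed
  finally have "A N * (norm (F (X N)))\<^sup>2 \<le> 7 / 2 * (norm (x0 - xs))\<^sup>2"
    using zero_le_power2[of "norm (X N - xs)"] unfolding V_def by linarith
  then show ?thesis by (simp add: A_def algebra_simps)
qed

theorem theorem4p2:
  fixes F :: "real ^ 'd \<Rightarrow> real ^ 'd" and L \<rho> :: real and xs :: "real ^ 'd"
  assumes "L > 0" and "\<rho> \<ge> 0"
    and "L-lipschitz_on UNIV F"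
    and "star_neg_comonotone \<rho> F"
    and "\<rho> < 1 / (2 * L)"
    and "F xs = 0"
  shows "(\<forall>\<gamma>1 \<gamma>2 x0. 2 * \<rho> < \<gamma>1 \<and> \<gamma>1 < 1 / L \<and> 0 < \<gamma>2 \<and> \<gamma>2 \<le> \<gamma>1 - 2 * \<rho> \<longrightarrow>
            (\<forall>N::nat. 1 / (real N + 1) * (\<Sum>k=0..N. (norm (F (eg_iterate F \<gamma>1 \<gamma>2 x0 k)))\<^sup>2)
               \<le> (norm (x0 - xs))\<^sup>2 / (\<gamma>1 * \<gamma>2 * (1 - L\<^sup>2 * \<gamma>1\<^sup>2) * (real N + 1))))
       \<and> (neg_comonotone \<rho> F \<and> \<rho> \<le> 1 / (8 * L) \<longrightarrow>
            (\<forall>\<gamma> x0. 0 < \<gamma> \<and> 4 * \<rho> \<le> \<gamma> \<and> \<gamma> \<le> 1 / (2 * L) \<longrightarrow>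
               (\<forall>k::nat. norm (F (eg_iterate F \<gamma> \<gamma> x0 (k + 1))) \<le> norm (F (eg_iterate F \<gamma> \<gamma> x0 k)))
             \<and> (\<forall>N::nat. N \<ge> 1 \<longrightarrow>
                  (norm (F (eg_iterate F \<gamma> \<gamma> x0 N)))\<^sup>2
                    \<le> 28 * (norm (x0 - xs))\<^sup>2 / (real N * \<gamma>\<^sup>2 + 320 * \<gamma> * \<rho>))))"
proof (intro conjI allI impI; (elim conjE)?)
  fix \<gamma>1 \<gamma>2 :: real and x0 :: "real ^ 'd" and N :: nat
  assume g: "2 * \<rho> < \<gamma>1" "\<gamma>1 < 1 / L" "0 < \<gamma>2" "\<gamma>2 \<le> \<gamma>1 - 2 * \<rho>"
  define C where "C = \<gamma>1 * \<gamma>2 * (1 - L\<^sup>2 * \<gamma>1\<^sup>2)"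
  define S where "S = (\<Sum>k=0..N. (norm (F (eg_iterate F \<gamma>1 \<gamma>2 x0 k)))\<^sup>2)"
  have "\<gamma>1 > 0" using g(1) \<open>\<rho> \<ge> 0\<close> by linarith
  have "L * \<gamma>1 < 1" using g(2) \<open>L > 0\<close> by (simp add: field_simps)
  then have "(L * \<gamma>1)\<^sup>2 < 1" using \<open>L > 0\<close> \<open>\<gamma>1 > 0\<close> by (simp add: power_less_one_iff)
  then have "C > 0" using \<open>\<gamma>1 > 0\<close> g(3) by (simp add: C_def power_mult_distrib)
  moreover have "C * S \<le> (norm (x0 - xs))\<^sup>2"
    unfolding C_def S_def using \<open>\<gamma>1 > 0\<close> g
    by (intro eg_sum_residuals_le[OF assms(3,4,6)]) auto
  ultimately have "S \<le> (norm (x0 - xs))\<^sup>2 / C"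
    by (simp add: pos_le_divide_eq mult.commute)
  from divide_right_mono[OF this, of "real N + 1"]
  show "1 / (real N + 1) * (\<Sum>k=0..N. (norm (F (eg_iterate F \<gamma>1 \<gamma>2 x0 k)))\<^sup>2)
      \<le> (norm (x0 - xs))\<^sup>2 / (\<gamma>1 * \<gamma>2 * (1 - L\<^sup>2 * \<gamma>1\<^sup>2) * (real N + 1))"
    unfolding C_def[symmetric] S_def[symmetric] by simp
next
  fix \<gamma> :: real and x0 :: "real ^ 'd"
  assume com: "neg_comonotone \<rho> F" and g: "0 < \<gamma>" "4 * \<rho> \<le> \<gamma>" "\<gamma> \<le> 1 / (2 * L)"
  have "L * \<gamma> \<le> 1 / 2" using g(3) \<open>L > 0\<close> by (simp add: field_simps)
  then have "(L * \<gamma>)\<^sup>2 \<le> (1 / 2)\<^sup>2" using \<open>L > 0\<close> g(1) by (intro power_mono) auto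
  then have contr: "L\<^sup>2 * \<gamma>\<^sup>2 \<le> 1 / 4" by (simp add: power_mult_distrib power_divide)
  show "norm (F (eg_iterate F \<gamma> \<gamma> x0 (k + 1))) \<le> norm (F (eg_iterate F \<gamma> \<gamma> x0 k))" for k
  proof (rule power2_le_imp_le)
    let ?x = "eg_iterate F \<gamma> \<gamma> x0 k"
    have "(norm (F (eg_iterate F \<gamma> \<gamma> x0 (k + 1))))\<^sup>2
        \<le> (norm (F ?x))\<^sup>2 - (norm (F ?x - F (eg_extrapolate F \<gamma> ?x)))\<^sup>2 / 16"
      using eg_residual_decrease[OF assms(3) com g(1,2) contr, of ?x] by simp
    also have "\<dots> \<le> (norm (F ?x))\<^sup>2" by simp
    finally show "(norm (F (eg_iterate F \<gamma> \<gamma> x0 (k + 1))))\<^sup>2 \<le> (norm (F ?x))\<^sup>2" .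
  qed simp
  fix N :: nat
  assume "N \<ge> 1"
  then have "real N * \<gamma>\<^sup>2 + 320 * \<gamma> * \<rho> > 0"
    using g(1) \<open>\<rho> \<ge> 0\<close> by (intro add_pos_nonneg) auto
  then show "(norm (F (eg_iterate F \<gamma> \<gamma> x0 N)))\<^sup>2
      \<le> 28 * (norm (x0 - xs))\<^sup>2 / (real N * \<gamma>\<^sup>2 + 320 * \<gamma> * \<rho>)"
    using eg_last_residual_le[OF assms(3,4,6) com g(1) \<open>\<rho> \<ge> 0\<close> g(2) contr, of N x0]
    by (simp add: pos_le_divide_eq mult.commute)
qed

end
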